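(* For every fixed integer $k\ge 2$, $$\mathrm{ex}_3(n,\widetilde C_{2k})=\Omega\left(n^{2+\frac{1}{2k-1}}\right)\quad\text{as } n\to\infty,$$ that is, there exist a constant $c_k>0$ and an integer $n_k$, depending only on $k$, such that $\mathrm{ex}_3(n,\widetilde C_{2k})\ge c_k\, n^{2+\frac1{2k-1}}$ for all $n\ge n_k$.
   Context: A 3-graph (3-uniform hypergraph, triple system) on a vertex set $V$ is a set of 3-element subsets of $V$, called (hyper)edges. For 3-graphs $G$ and $H$, $G$ is $H$-free if $G$ contains no (not necessarily induced) subgraph isomorphic to $H$. $\mathrm{ex}_3(n,H)$ is the maximum number of edges in an $H$-free 3-graph on $n$ vertices. $C_{2k}$ is the cycle with $2k$ vertices. For a graph $G$, the hypergraph suspension $\widetilde G$ is the 3-graph obtained by adding one new vertex $x$ to $V(G)$ and taking as hyperedges the sets $e\cup\{x\}$ for $e\in E(G)$. *)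

theory Defs
  imports Complex_Main
begin

text \<open>A (hyper)graph is a pair of a vertex set and a set of edges, each edge being a set of
  vertices. Simple graphs are the 2-uniform ones, 3-graphs the 3-uniform ones.\<close>

type_synonym 'a hypergraph = "'a set \<times> 'a set set"

abbreviation verts :: "'a hypergraph \<Rightarrow> 'a set" where
  "verts \<equiv> fst"

abbreviation edges :: "'a hypergraph \<Rightarrow> 'a set set" where
  "edges \<equiv> snd"

definition uniform :: "nat \<Rightarrow> 'a hypergraph \<Rightarrow> bool" where
  "uniform r G \<longleftrightarrow> finite (verts G) \<and> (\<forall>e\<in>edges G. e \<subseteq> verts G \<and> card e = r)"

definition subhypergraph :: "'a hypergraph \<Rightarrow> 'a hypergraph \<Rightarrow> bool" where
  "subhypergraph F G \<longleftrightarrow>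
     verts F \<subseteq> verts G \<and> edges F \<subseteq> edges G \<and> (\<forall>e\<in>edges F. e \<subseteq> verts F)"

definition isomorphic :: "'a hypergraph \<Rightarrow> 'b hypergraph \<Rightarrow> bool" where
  "isomorphic F H \<longleftrightarrow>
     (\<exists>f. bij_betw f (verts F) (verts H) \<and> (\<lambda>e. f ` e) ` edges F = edges H)"

definition free_of :: "'b hypergraph \<Rightarrow> 'a hypergraph \<Rightarrow> bool" where
  "free_of H G \<longleftrightarrow> \<not> (\<exists>F. subhypergraph F G \<and> isomorphic F H)"

text \<open>Vertices are taken in \<open>nat\<close>, which is no restriction up to isomorphism.\<close>

definition free_edge_counts :: "nat \<Rightarrow> 'b hypergraph \<Rightarrow> nat set" where
  "free_edge_counts n H =
     {card (edges G) | G :: nat hypergraph. uniform 3 G \<and> card (verts G) = n \<and> free_of H G}"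

text \<open>The maximum exists as soon as \<open>H\<close> has an edge, see \<open>finite_free_edge_counts\<close> and
  \<open>free_edge_counts_nonempty\<close> below.\<close>

definition ex3 :: "nat \<Rightarrow> 'b hypergraph \<Rightarrow> nat" where
  "ex3 n H = Max (free_edge_counts n H)"

text \<open>The cycle with \<open>m\<close> vertices; meaningful for \<open>m \<ge> 3\<close>.\<close>

definition cycle_graph :: "nat \<Rightarrow> nat hypergraph" where
  "cycle_graph m = ({..<m}, {{i, Suc i mod m} | i. i < m})"

text \<open>The new vertex of the suspension is \<open>None\<close>.\<close>

definition suspension :: "'a hypergraph \<Rightarrow> 'a option hypergraph" where
  "suspension G = (insert None (Some ` verts G), {insert None (Some ` e) | e. e \<in> edges G})"

lemma uniform_cycle_graph:
  assumes "m \<ge> 3"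
  shows "uniform 2 (cycle_graph m)"
proof -
  have "Suc i mod m \<noteq> i" if "i < m" for i
    using that assms by (cases "Suc i = m") auto
  then show ?thesis
    using assms by (fastforce simp: uniform_def cycle_graph_def card_2_iff)
qed

lemma uniform_suspension:
  assumes "uniform 2 G"
  shows "uniform 3 (suspension G)"
proof -
  have "card (insert None (Some ` e)) = 3" if "e \<in> edges G" for e
  proof -
    have "card e = 2" "finite e"
      using that assms by (auto simp: uniform_def intro: finite_subset)
    then show ?thesis
      by (simp add: card_image)
  qed
  then show ?thesis
    using assms by (fastforce simp: uniform_def suspension_def)
qed

lemma finite_free_edge_counts: "finite (free_edge_counts n H)"
proof -
  have "card (edges G) \<le> 2 ^ n" if "uniform 3 G" "card (verts G) = n" for G :: "nat hypergraph"
  proof -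
    have "edges G \<subseteq> Pow (verts G)" "finite (verts G)"
      using that by (auto simp: uniform_def)
    then show ?thesis
      using that(2) card_mono[of "Pow (verts G)" "edges G"] by (simp add: card_Pow)
  qed
  then have "free_edge_counts n H \<subseteq> {..2 ^ n}"
    by (auto simp: free_edge_counts_def)
  then show ?thesis
    by (rule finite_subset) simp
qed

lemma free_edge_counts_nonempty:
  assumes "edges H \<noteq> {}"
  shows "free_edge_counts n H \<noteq> {}"
proof -
  have "uniform 3 ({..<n}, {})" "free_of H ({..<n}, {})"
    using assms by (auto simp: uniform_def free_of_def subhypergraph_def isomorphic_def)
  then have "card (edges ({..<n}, {} :: nat set set)) \<in> free_edge_counts n H"
    unfolding free_edge_counts_def by force
  then show ?thesis by blast
qed

end

theory Submission
  imports Defs "HOL-Library.FuncSet"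
begin

text \<open>
  The bound is an instance of the deletion method. Let \<open>H\<close> be a 3-graph with \<open>v\<close> vertices and
  \<open>e \<ge> 2\<close> edges. Keep every triple of an \<open>n\<close>-set independently with probability \<open>1/q\<close>. The expected
  number of surviving triples is \<open>(n choose 3) / q\<close>, and the expected number of surviving copies of
  \<open>H\<close> is at most \<open>n\<^sup>v / q\<^sup>e\<close>, since a copy is determined by a map from the vertices of \<open>H\<close>. Deleting
  one triple from each surviving copy leaves an \<open>H\<close>-free 3-graph, so
  \<open>ex\<^sub>3(n, H) \<ge> (n choose 3) / q - n\<^sup>v / q\<^sup>e\<close> (lemma \<open>ex3_deletion_bound\<close>). With \<open>q\<close> of order
  \<open>n powr ((v - 3) / (e - 1))\<close> the second term is at most half of the first one, which gives
  \<open>ex\<^sub>3(n, H) = \<Omega>(n powr (3 - (v - 3) / (e - 1)))\<close> (lemma \<open>ex3_power_bound\<close>).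

  The suspension of \<open>C\<^bsub>2k\<^esub>\<close> has \<open>v = 2k + 1\<close> vertices and \<open>e = 2k\<close> edges, and
  \<open>3 - (2k - 2) / (2k - 1) = 2 + 1 / (2k - 1)\<close>.

  As \<open>q\<close> is an integer, probability reduces to counting: a triple is kept if a uniformly
  random colouring with \<open>q\<close> colours gives it the colour \<open>0\<close>.
\<close>

section \<open>Deletion in set systems\<close>

lemma card_colourings_zero_on:
  fixes q :: nat
  assumes "finite T" "B \<subseteq> T" "q > 0"
  shows "real (card {f \<in> T \<rightarrow>\<^sub>E {..<q}. \<forall>x\<in>B. f x = 0}) = real q ^ card T / real q ^ card B"
proof -
  have "{f \<in> T \<rightarrow>\<^sub>E {..<q}. \<forall>x\<in>B. f x = 0} = PiE T (\<lambda>x. if x \<in> B then {0} else {..<q})"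
    using assms by (fastforce simp: PiE_iff split: if_splits)
  moreover have "card (PiE T (\<lambda>x. if x \<in> B then {0} else {..<q})) = q ^ card (T - B)"
  proof -
    have "card (PiE T (\<lambda>x. if x \<in> B then {0} else {..<q}))
        = (\<Prod>x\<in>T. if x \<in> B then 1 else q)"
      using assms by (simp add: card_PiE if_distrib cong: if_cong)
    also have "\<dots> = (\<Prod>x\<in>T - B. q)"
      using assms by (intro prod.mono_neutral_cong_right) auto
    finally show ?thesis by simp
  qed
  moreover have "card (T - B) = card T - card B" "card B \<le> card T"
    using assms by (auto simp: card_Diff_subset finite_subset card_mono)
  ultimately have "real (card {f \<in> T \<rightarrow>\<^sub>E {..<q}. \<forall>x\<in>B. f x = 0}) = real q ^ (card T - card B)"
    by simp
  then show ?thesis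
    using \<open>card B \<le> card T\<close> \<open>q > 0\<close> by (simp add: power_diff)
qed

text \<open>The deletion method in general form. The colour class of \<open>0\<close> in a random colouring has
  \<open>card T / q\<close> points and contains \<open>card \<F> / q\<^sup>e\<close> members of \<open>\<F>\<close> on average, so for some
  colouring the difference is at least the difference of these averages; then one point of each
  surviving member is removed.\<close>

lemma independent_set_by_deletion:
  fixes q :: nat
  assumes T: "finite T" and \<F>: "\<And>B. B \<in> \<F> \<Longrightarrow> B \<subseteq> T \<and> card B = e" and "e > 0" "q > 0"
  shows "\<exists>S\<subseteq>T. (\<forall>B\<in>\<F>. \<not> B \<subseteq> S) \<and>
           real (card S) \<ge> real (card T) / real q - real (card \<F>) / real q ^ e"
proof -
  have fin\<F>: "finite \<F>"
    using T \<F> by (intro finite_subset[of \<F> "Pow T"]) auto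
  define \<Omega> where "\<Omega> = T \<rightarrow>\<^sub>E {..<q}"
  define Z where "Z = (\<lambda>f :: 'a \<Rightarrow> nat. {x \<in> T. f x = 0})"
  define bad where "bad = (\<lambda>f. {B \<in> \<F>. B \<subseteq> Z f})"
  define avg where "avg = real (card T) / real q - real (card \<F>) / real q ^ e"
  have fin\<Omega>: "finite \<Omega>" and card\<Omega>: "card \<Omega> = q ^ card T"
    using T by (auto simp: \<Omega>_def finite_PiE card_PiE)
  have ne\<Omega>: "\<Omega> \<noteq> {}"
    using card\<Omega> \<open>q > 0\<close> by auto
  have points: "(\<Sum>f\<in>\<Omega>. real (card (Z f))) = real (card \<Omega>) * (real (card T) / real q)"
  proof -
    have "(\<Sum>f\<in>\<Omega>. real (card (Z f))) = (\<Sum>f\<in>\<Omega>. \<Sum>x\<in>T. if f x = 0 then 1 else 0)"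
      using T by (simp add: Z_def sum.If_cases Int_def)
    also have "\<dots> = (\<Sum>x\<in>T. \<Sum>f\<in>\<Omega>. if f x = 0 then 1 else 0)"
      by (rule sum.swap)
    also have "\<dots> = (\<Sum>x\<in>T. real (card {f \<in> \<Omega>. \<forall>y\<in>{x}. f y = 0}))"
      using fin\<Omega> by (simp add: sum.If_cases Int_def)
    also have "\<dots> = (\<Sum>x\<in>T. real (card \<Omega>) / real q)"
      unfolding \<Omega>_def using T \<open>q > 0\<close> card\<Omega>[unfolded \<Omega>_def]
      by (intro sum.cong refl) (subst card_colourings_zero_on, auto)
    finally show ?thesis by simp
  qed
  have copies: "(\<Sum>f\<in>\<Omega>. real (card (bad f))) = real (card \<Omega>) * (real (card \<F>) / real q ^ e)"
  proof -
    have "(\<Sum>f\<in>\<Omega>. real (card (bad f))) = (\<Sum>f\<in>\<Omega>. \<Sum>B\<in>\<F>. if B \<subseteq> Z f then 1 else 0)"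
      using fin\<F> by (simp add: bad_def sum.If_cases Int_def)
    also have "\<dots> = (\<Sum>B\<in>\<F>. \<Sum>f\<in>\<Omega>. if B \<subseteq> Z f then 1 else 0)"
      by (rule sum.swap)
    also have "\<dots> = (\<Sum>B\<in>\<F>. real (card {f \<in> \<Omega>. \<forall>y\<in>B. f y = 0}))"
    proof (intro sum.cong refl)
      fix B assume "B \<in> \<F>"
      then have "{f \<in> \<Omega>. B \<subseteq> Z f} = {f \<in> \<Omega>. \<forall>y\<in>B. f y = 0}"
        using \<F> by (auto simp: Z_def)
      then show "(\<Sum>f\<in>\<Omega>. if B \<subseteq> Z f then 1 else 0) = real (card {f \<in> \<Omega>. \<forall>y\<in>B. f y = 0})"
        using fin\<Omega> by (simp add: sum.If_cases Int_def)
    qed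
    also have "\<dots> = (\<Sum>B\<in>\<F>. real (card \<Omega>) / real q ^ e)"
      unfolding \<Omega>_def using T \<open>q > 0\<close> card\<Omega>[unfolded \<Omega>_def] \<F>
      by (intro sum.cong refl) (subst card_colourings_zero_on, auto)
    finally show ?thesis by simp
  qed
  have "\<exists>f\<in>\<Omega>. real (card (Z f)) - real (card (bad f)) \<ge> avg"
  proof (rule ccontr)
    assume "\<not> ?thesis"
    then have "(\<Sum>f\<in>\<Omega>. real (card (Z f)) - real (card (bad f))) < (\<Sum>f\<in>\<Omega>. avg)"
      using fin\<Omega> ne\<Omega> by (intro sum_strict_mono) auto
    then show False
      by (simp add: sum_subtractf points copies avg_def right_diff_distrib)
  qed
  then obtain f where f: "real (card (Z f)) - real (card (bad f)) \<ge> avg"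
    by blast
  have "\<exists>x. x \<in> B" if "B \<in> \<F>" for B
    using \<F>[OF that] \<open>e > 0\<close> by (metis card_gt_0_iff ex_in_conv)
  then obtain pick where pick: "\<And>B. B \<in> \<F> \<Longrightarrow> pick B \<in> B"
    by metis
  define S where "S = Z f - pick ` bad f"
  have finbad: "finite (bad f)"
    using fin\<F> by (simp add: bad_def)
  have "card (Z f) - card (bad f) \<le> card S"
    unfolding S_def
    using diff_card_le_card_Diff[of "pick ` bad f" "Z f"] card_image_le[OF finbad, of pick] finbad
    by simp
  then have "real (card S) \<ge> avg"
    using f by linarith
  moreover have "\<not> B \<subseteq> S" if "B \<in> \<F>" for B
  proof
    assume "B \<subseteq> S"
    then have "B \<in> bad f"
      using that by (auto simp: S_def bad_def)
    then show False
      using pick[OF that] \<open>B \<subseteq> S\<close> by (auto simp: S_def)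
  qed
  moreover have "S \<subseteq> T"
    by (auto simp: S_def Z_def)
  ultimately show ?thesis
    unfolding avg_def by blast
qed

section \<open>A lower bound for Turan numbers of 3-graphs\<close>

text \<open>The vertex maps from \<open>H\<close> yield all copies of \<open>H\<close>, and possibly further edge sets when they
  are not injective; overcounting only affects constants.\<close>

definition copies_within :: "'b set \<Rightarrow> 'a hypergraph \<Rightarrow> 'b set set set" where
  "copies_within V H = (\<lambda>g. (\<lambda>a. g ` a) ` edges H) ` (verts H \<rightarrow>\<^sub>E V)"

lemma card_copies_within_le:
  assumes "finite (verts H)" "finite V"
  shows "finite (copies_within V H)" "card (copies_within V H) \<le> card V ^ card (verts H)"
proof -
  have fin: "finite (verts H \<rightarrow>\<^sub>E V)"
    using assms by (intro finite_PiE) auto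
  then show "finite (copies_within V H)"
    by (simp add: copies_within_def)
  show "card (copies_within V H) \<le> card V ^ card (verts H)"
    unfolding copies_within_def using card_image_le[OF fin] assms by (simp add: card_PiE)
qed

lemma edges_of_copy:
  assumes "isomorphic F H" "verts F \<subseteq> V" "\<forall>a\<in>edges F. a \<subseteq> verts F"
  shows "edges F \<in> copies_within V H" "card (edges F) = card (edges H)"
proof -
  obtain f where f: "bij_betw f (verts F) (verts H)" "(\<lambda>a. f ` a) ` edges F = edges H"
    using assms(1) by (auto simp: isomorphic_def)
  define g where "g = restrict (the_inv_into (verts F) f) (verts H)"
  have inj: "inj_on f (verts F)" and im: "f ` verts F = verts H"
    using f(1) by (auto simp: bij_betw_def)
  have gf: "g (f x) = x" if "x \<in> verts F" for x
    using that im by (auto simp: g_def the_inv_into_f_f[OF inj])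
  have "g \<in> verts H \<rightarrow>\<^sub>E V"
    using assms(2) bij_betwE[OF bij_betw_the_inv_into[OF f(1)]] by (auto simp: g_def)
  moreover have "(\<lambda>a. g ` a) ` edges H = edges F"
  proof -
    have "g ` f ` a = a" if "a \<in> edges F" for a
      using assms(3) that gf by (force simp: image_image)
    then show ?thesis
      by (simp add: f(2)[symmetric] image_image)
  qed
  ultimately show "edges F \<in> copies_within V H"
    unfolding copies_within_def by blast
  have "inj_on (\<lambda>a. f ` a) (edges F)"
    using assms(3) inj by (intro inj_onI) (metis inj_on_image_eq_iff)
  then show "card (edges F) = card (edges H)"
    using f(2) card_image by metis
qed

lemma ex3_deletion_bound:
  fixes H :: "'a hypergraph" and q :: nat
  assumes "finite (verts H)" and "card (edges H) > 0" and "q > 0"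
  shows "real (ex3 n H) \<ge> real (n choose 3) / real q
           - real n ^ card (verts H) / real q ^ card (edges H)"
proof -
  define V where "V = {..<n}"
  define T where "T = {a. a \<subseteq> V \<and> card a = 3}"
  define \<F> where "\<F> = {B \<in> copies_within V H. B \<subseteq> T \<and> card B = card (edges H)}"
  have T: "finite T" "card T = n choose 3"
    using n_subsets[of V 3] by (auto simp: T_def V_def)
  obtain S where S: "S \<subseteq> T" "\<forall>B\<in>\<F>. \<not> B \<subseteq> S"
    "real (card S) \<ge> real (card T) / real q - real (card \<F>) / real q ^ card (edges H)"
    using independent_set_by_deletion[of T \<F> "card (edges H)" q] T assms
    unfolding \<F>_def by auto
  have "uniform 3 (V, S)"
    using S(1) by (auto simp: uniform_def T_def V_def)
  moreover have "free_of H (V, S)"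
    unfolding free_of_def
  proof safe
    fix F assume F: "subhypergraph F (V, S)" "isomorphic F H"
    then have "edges F \<in> \<F>"
      using edges_of_copy[of F H V] S(1) by (auto simp: subhypergraph_def \<F>_def)
    then show False
      using S(2) F(1) by (auto simp: subhypergraph_def)
  qed
  ultimately have "card S \<in> free_edge_counts n H"
    unfolding free_edge_counts_def by (force simp: V_def)
  then have "card S \<le> ex3 n H"
    unfolding ex3_def by (intro Max_ge finite_free_edge_counts)
  moreover have "card \<F> \<le> n ^ card (verts H)"
  proof -
    have "card \<F> \<le> card (copies_within V H)"
      using card_copies_within_le[OF assms(1), of V]
      by (intro card_mono) (auto simp: \<F>_def V_def)
    also have "\<dots> \<le> n ^ card (verts H)"
      using card_copies_within_le[OF assms(1), of V] by (simp add: V_def)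
    finally show ?thesis .
  qed
  then have "real (card \<F>) / real q ^ card (edges H)
      \<le> real n ^ card (verts H) / real q ^ card (edges H)"
    by (intro divide_right_mono) (simp_all flip: of_nat_power)
  ultimately show ?thesis
    using S(3)[unfolded T(2)] by linarith
qed

text \<open>Since \<open>(n choose 3) \<ge> n\<^sup>3 / 27\<close>, the subtracted term of the deletion bound is at most half of
  the main term as soon as \<open>q ^ (e - 1) \<ge> 54 * n ^ (v - 3)\<close>, for which rounding up
  \<open>54 * n powr ((v - 3) / (e - 1))\<close> suffices. Rounding raises the factor to at most \<open>55\<close>, and
  \<open>2970 = 54 * 55\<close>.\<close>

lemma ex3_power_bound:
  fixes H :: "'a hypergraph"
  assumes "finite (verts H)" and v: "card (verts H) = v" "v \<ge> 3"
    and e: "card (edges H) = e" "e \<ge> 2" and n: "n \<ge> 3"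
  shows "real (ex3 n H) \<ge> real n powr (3 - (real v - 3) / (real e - 1)) / 2970"
proof -
  define t where "t = (real v - 3) / (real e - 1)"
  define q where "q = nat \<lceil>54 * real n powr t\<rceil>"
  have t0: "t \<ge> 0"
    using v e by (simp add: t_def)
  have nt: "real n powr t \<ge> 1"
    using n t0 by (simp add: ge_one_powr_ge_zero)
  have q_lower: "real q \<ge> 54 * real n powr t"
    unfolding q_def by linarith
  have q_upper: "real q \<le> 55 * real n powr t"
    using nt unfolding q_def by linarith
  have q0: "real q > 0"
    using q_lower nt by linarith
  have "54 * real n ^ (v - 3) \<le> real q ^ (e - 1)"
  proof -
    have "54 * real n ^ (v - 3) = 54 * (real n powr t) ^ (e - 1)"
    proof -
      have "(real n powr t) ^ (e - 1) = real n powr (real v - 3)"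
        using e n by (simp add: t_def powr_realpow[symmetric] powr_powr of_nat_diff)
      also have "\<dots> = real n ^ (v - 3)"
        using v n by (simp add: powr_realpow[symmetric] of_nat_diff)
      finally show ?thesis by simp
    qed
    also have "\<dots> \<le> 54 ^ (e - 1) * (real n powr t) ^ (e - 1)"
      using e self_le_power[of "54::real" "e - 1"] by (intro mult_right_mono) auto
    also have "\<dots> = (54 * real n powr t) ^ (e - 1)"
      by (simp add: power_mult_distrib)
    also have "\<dots> \<le> real q ^ (e - 1)"
      using q_lower by (intro power_mono) auto
    finally show ?thesis .
  qed
  then have "54 * real n ^ (v - 3) * (real n ^ 3 * real q) \<le> real q ^ (e - 1) * (real n ^ 3 * real q)"
    by (rule mult_right_mono) simp
  moreover have "real n ^ v = real n ^ (v - 3) * real n ^ 3" "real q ^ e = real q ^ (e - 1) * real q"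
    using v e by (simp_all flip: power_add power_Suc2)
  ultimately have "54 * real n ^ v * real q \<le> real n ^ 3 * real q ^ e"
    by (simp only: mult_ac)
  then have subtracted: "real n ^ v / real q ^ e \<le> real n ^ 3 / (54 * real q)"
    using q0 by (simp add: field_simps)
  have "(real n / real 3) ^ 3 \<le> real (n choose 3)"
    using n binomial_ge_n_over_k_pow_k[of 3 n, where 'a = real] by simp
  then have "real n ^ 3 / 27 / real q \<le> real (n choose 3) / real q"
    by (intro divide_right_mono) (simp_all add: power_divide)
  then have "real n ^ 3 / (54 * real q) \<le> real (n choose 3) / real q - real n ^ v / real q ^ e"
    using subtracted by (simp add: field_simps)
  also have "\<dots> \<le> real (ex3 n H)"
    using ex3_deletion_bound[OF assms(1), of q n] v e q0 by simp
  finally have "real n ^ 3 / (54 * real q) \<le> real (ex3 n H)" .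
  moreover have "real n ^ 3 / (54 * (55 * real n powr t)) \<le> real n ^ 3 / (54 * real q)"
    using q_upper q0 n by (intro divide_left_mono) auto
  moreover have "real n ^ 3 / (54 * (55 * real n powr t)) = real n powr (3 - t) / 2970"
    using n by (simp add: powr_diff)
  ultimately show ?thesis
    unfolding t_def by linarith
qed

section \<open>Suspensions of cycles\<close>

lemma card_edges_cycle_graph:
  assumes "m \<ge> 3"
  shows "card (edges (cycle_graph m)) = m"
proof -
  have "edges (cycle_graph m) = (\<lambda>i. {i, Suc i mod m}) ` {..<m}"
    by (auto simp: cycle_graph_def)
  moreover have "inj_on (\<lambda>i. {i, Suc i mod m}) {..<m}"
  proof (rule inj_onI)
    fix i j assume "i \<in> {..<m}" "j \<in> {..<m}" "{i, Suc i mod m} = {j, Suc j mod m}"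
    then show "i = j"
      using assms by (auto simp: doubleton_eq_iff mod_Suc split: if_splits)
  qed
  ultimately show ?thesis
    by (simp add: card_image)
qed

lemma card_verts_suspension:
  assumes "finite (verts G)"
  shows "card (verts (suspension G)) = Suc (card (verts G))"
  using assms by (simp add: suspension_def card_image)

lemma card_edges_suspension: "card (edges (suspension G)) = card (edges G)"
proof -
  have "edges (suspension G) = (\<lambda>a. insert None (Some ` a)) ` edges G"
    by (auto simp: suspension_def)
  moreover have "inj_on (\<lambda>a. insert None (Some ` a)) (edges G)"
    by (intro inj_onI) (auto simp: set_eq_iff)
  ultimately show ?thesis
    by (simp add: card_image)
qed

theorem proposition1p1:
  fixes k :: nat
  assumes "k \<ge> 2"
  shows "\<exists>c::real. c > 0 \<and> (\<exists>n0::nat. \<forall>n\<ge>n0.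
           real (ex3 n (suspension (cycle_graph (2 * k)))) \<ge> c * real n powr (2 + 1 / (2 * real k - 1)))"
proof -
  let ?H = "suspension (cycle_graph (2 * k))"
  have verts: "finite (verts ?H)" "card (verts ?H) = 2 * k + 1"
    using card_verts_suspension[of "cycle_graph (2 * k)"]
    by (auto simp: suspension_def cycle_graph_def)
  have edges: "card (edges ?H) = 2 * k"
    using assms by (simp add: card_edges_suspension card_edges_cycle_graph)
  have exponent: "3 - (real (2 * k + 1) - 3) / (real (2 * k) - 1) = 2 + 1 / (2 * real k - 1)"
    using assms by (simp add: field_simps)
  have "real (ex3 n ?H) \<ge> 1 / 2970 * real n powr (2 + 1 / (2 * real k - 1))" if "n \<ge> 3" for n
    using ex3_power_bound[OF verts _ edges _ that] assms unfolding exponent by simp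
  then show ?thesis
    by (intro exI[of _ "1 / 2970"] conjI exI[of _ 3]) auto
qed

end
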